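(* Let $G$ be a simple connected graph with $p \geq 2$ vertices and diameter $d$. Let $L_0$ be any nonempty set of vertices of $G$ (the vertex set of an induced subgraph of $G$), and let $k = \max\{d(u,v) : u,v \in L_0\}$, where $d$ denotes the distance in $G$. Define $L_1 = N(L_0)\setminus L_0$ and recursively $L_{i+1} = N(L_i)\setminus (L_0\cup \cdots \cup L_i)$, where $N(S)$ is the set of vertices adjacent to some vertex of $S$; let $h$ be the largest index with $L_h \neq \emptyset$. Let $\delta = 0$ if $|L_0|\geq 2$ and $\delta = 1$ if $|L_0| = 1$. Then $$\mathrm{rn}(G) \geq (p-1)(d-k+1)+\delta-2\sum_{i=0}^{h}|L_i|\, i.$$
   Context: A radio labeling of a connected graph $G$ is a map $\varphi: V(G)\to\{0,1,2,\dots\}$ such that $d(u,v)+|\varphi(u)-\varphi(v)| \geq \mathrm{diam}(G)+1$ for every pair of distinct vertices $u,v$, where $d(u,v)$ is the graph distance and $\mathrm{diam}(G)$ the diameter. The span of $\varphi$ is $\max\{|\varphi(u)-\varphi(v)| : u,v\in V(G)\}$, and the radio number $\mathrm{rn}(G)$ is the minimum span over all radio labelings of $G$. Note that $L_i$ is exactly the set of vertices at distance $i$ from $L_0$. *)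

theory Defs
  imports "Graph_Theory.Graph_Theory"
begin

text \<open>
  Finite simple graphs are represented by the locale \<^locale>\<open>graph\<close>: finite, loop-free,
  symmetric digraphs without parallel arcs, so that each undirected edge is a pair of opposite arcs.
\<close>

text \<open>The set of walks is nonempty whenever the graph is connected, so the infimum is a minimum.\<close>

definition graph_dist :: "('a, 'b) pre_digraph \<Rightarrow> 'a \<Rightarrow> 'a \<Rightarrow> nat" where
  "graph_dist G u v = (INF p \<in> {p. pre_digraph.awalk G u p v}. length p)"

text \<open>Distances are always measured in the whole graph, not in the subgraph induced by \<open>S\<close>.\<close>

definition set_diam :: "('a, 'b) pre_digraph \<Rightarrow> 'a set \<Rightarrow> nat" where
  "set_diam G S = (MAX (u, v) \<in> S \<times> S. graph_dist G u v)"

definition diam :: "('a, 'b) pre_digraph \<Rightarrow> nat" where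
  "diam G = set_diam G (verts G)"

definition radio_labeling :: "('a, 'b) pre_digraph \<Rightarrow> ('a \<Rightarrow> nat) \<Rightarrow> bool" where
  "radio_labeling G \<phi> \<longleftrightarrow>
    (\<forall>u \<in> verts G. \<forall>v \<in> verts G. u \<noteq> v \<longrightarrow>
      int (graph_dist G u v) + \<bar>int (\<phi> u) - int (\<phi> v)\<bar> \<ge> int (diam G) + 1)"

definition label_span :: "('a, 'b) pre_digraph \<Rightarrow> ('a \<Rightarrow> nat) \<Rightarrow> nat" where
  "label_span G \<phi> = (MAX (u, v) \<in> verts G \<times> verts G. nat \<bar>int (\<phi> u) - int (\<phi> v)\<bar>)"

text \<open>Every finite connected graph has a radio labeling, so this infimum is attained as well.\<close>

definition radio_number :: "('a, 'b) pre_digraph \<Rightarrow> nat" where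
  "radio_number G = (INF \<phi> \<in> {\<phi>. radio_labeling G \<phi>}. label_span G \<phi>)"

definition nbhd :: "('a, 'b) pre_digraph \<Rightarrow> 'a set \<Rightarrow> 'a set" where
  "nbhd G S = {v \<in> verts G. \<exists>u \<in> S. u \<rightarrow>\<^bsub>G\<^esub> v}"

function layer :: "('a, 'b) pre_digraph \<Rightarrow> 'a set \<Rightarrow> nat \<Rightarrow> 'a set" where
  "layer G S 0 = S"
| "layer G S (Suc i) = nbhd G (layer G S i) - (\<Union>j \<in> {..i}. layer G S j)"
  by pat_completeness auto
termination by (relation "measure (\<lambda>(G, S, i). i)") auto

definition last_layer :: "('a, 'b) pre_digraph \<Rightarrow> 'a set \<Rightarrow> nat" where
  "last_layer G S = Max {i. layer G S i \<noteq> {}}"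

end

theory Submission
  imports Defs
begin

text \<open>
  Order the vertices by label. Consecutive vertices \<open>u\<close>, \<open>v\<close> at levels \<open>i\<close>, \<open>j\<close> are at distance at
  most \<open>i + k + j\<close>, travelling through \<open>L\<^sub>0\<close>, so their labels differ by at least
  \<open>d + 1 - k - i - j\<close>. Summing along the order counts every level twice, except those of the two
  extreme vertices, which cannot both vanish when \<open>L\<^sub>0\<close> is a single vertex.
\<close>

lemma graph_dist_le_length:
  assumes "pre_digraph.awalk G u p v"
  shows "graph_dist G u v \<le> length p"
  unfolding graph_dist_def using assms by (intro cINF_lower) auto

lemma graph_dist_attained:
  assumes "pre_digraph.awalk G u q v"
  obtains p where "pre_digraph.awalk G u p v" "length p = graph_dist G u v"
proof -
  have "graph_dist G u v \<in> length ` {p. pre_digraph.awalk G u p v}"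
    unfolding graph_dist_def using assms by (intro Inf_nat_def1) auto
  then show thesis using that by fastforce
qed

lemma graph_dist_le_set_diam:
  assumes "finite S" "u \<in> S" "v \<in> S"
  shows "graph_dist G u v \<le> set_diam G S"
  unfolding set_diam_def using assms by (intro Max_ge) (auto intro!: image_eqI[of _ _ "(u, v)"])

lemma layer_subset_verts:
  assumes "S \<subseteq> verts G"
  shows "layer G S i \<subseteq> verts G"
  using assms by (cases i) (auto simp: nbhd_def)

lemma layer_disjoint:
  assumes "i < j"
  shows "layer G S i \<inter> layer G S j = {}"
  using assms by (cases j) auto

lemma layer_unique:
  assumes "v \<in> layer G S i" "v \<in> layer G S j"
  shows "i = j"
  using assms layer_disjoint[of i j G S] layer_disjoint[of j i G S]
  by (cases i j rule: linorder_cases) auto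

text \<open>Layers are pairwise disjoint, so picking one vertex from each nonempty layer is an
  injection into the finite vertex set. This makes the \<open>Max\<close> in
  \<open>last_layer\<close> meaningful.\<close>

lemma finite_nonempty_layers:
  assumes "finite (verts G)" "S \<subseteq> verts G"
  shows "finite {i. layer G S i \<noteq> {}}"
proof (rule inj_on_finite)
  let ?f = "\<lambda>i. SOME v. v \<in> layer G S i"
  have f: "?f i \<in> layer G S i" if "layer G S i \<noteq> {}" for i
    using that by (simp add: some_in_eq)
  show "inj_on ?f {i. layer G S i \<noteq> {}}"
    by (rule inj_onI) (metis (mono_tags, lifting) f layer_unique mem_Collect_eq)
  show "?f ` {i. layer G S i \<noteq> {}} \<subseteq> verts G"
    using f layer_subset_verts[OF assms(2)] by blast
qed (rule assms(1))

lemma layer_index_le_last_layer: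
  assumes "finite (verts G)" "S \<subseteq> verts G" "v \<in> layer G S i"
  shows "i \<le> last_layer G S"
  unfolding last_layer_def using assms by (intro Max_ge finite_nonempty_layers) auto

text \<open>An arc leaving layer \<open>i\<close> ends in layer \<open>Suc i\<close> unless its head
  already lies in an earlier layer, so a walk never escapes the layers. With connectedness, the
  layers cover all vertices.\<close>

lemma (in wf_digraph) awalk_end_in_layer:
  assumes "awalk u p v" "u \<in> layer G S i"
  shows "\<exists>j. v \<in> layer G S j"
  using assms
proof (induction p arbitrary: u i)
  case Nil
  then show ?case by (auto simp: awalk_Nil_iff)
next
  case (Cons e p)
  then have e: "e \<in> arcs G" "u = tail G e" and p: "awalk (head G e) p v"
    by (auto simp: awalk_Cons_iff)
  have "head G e \<in> nbhd G (layer G S i)"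
    using e Cons.prems(2) by (auto simp: nbhd_def intro: in_arcs_imp_in_arcs_ends)
  then have "head G e \<in> layer G S (Suc i) \<or> (\<exists>j\<le>i. head G e \<in> layer G S j)"
    by auto
  then show ?case using Cons.IH[OF p] by blast
qed

text \<open>Stepping back one layer at a time reaches \<open>S\<close>. Both directions are recorded
  because walks are directed: a route through \<open>S\<close> enters by \<open>q\<close> at one end
  and leaves by \<open>p\<close> at the other.\<close>

lemma (in sym_digraph) layer_awalks:
  assumes "S \<subseteq> verts G" "v \<in> layer G S i"
  shows "\<exists>a\<in>S. \<exists>p q. awalk a p v \<and> awalk v q a \<and> length p = i \<and> length q = i"
  using assms(2)
proof (induction i arbitrary: v)
  case 0
  then show ?case using assms(1) by (auto simp: awalk_Nil_iff)
next
  case (Suc i)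
  then obtain u where u: "u \<in> layer G S i" and uv: "u \<rightarrow>\<^bsub>G\<^esub> v"
    by (auto simp: nbhd_def)
  then have "v \<rightarrow>\<^bsub>G\<^esub> u"
    using sym_arcs unfolding symmetric_def by (metis symD)
  then obtain f where f: "awalk v [f] u"
    by (auto simp: arcs_ends_def arc_to_ends_def dest: arc_implies_awalk)
  obtain e where e: "awalk u [e] v"
    using uv by (auto simp: arcs_ends_def arc_to_ends_def dest: arc_implies_awalk)
  obtain a p q where a: "a \<in> S" and p: "awalk a p u" "length p = i"
    and q: "awalk u q a" "length q = i"
    using Suc.IH[OF u] by blast
  have "awalk a (p @ [e]) v" "awalk v ([f] @ q) a"
    using p(1) e f q(1) by (blast intro: awalk_appendI)+
  moreover have "length (p @ [e]) = Suc i" "length ([f] @ q) = Suc i"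
    using p(2) q(2) by auto
  ultimately show ?case using a by blast
qed

text \<open>The route descends from \<open>u\<close> to some \<open>a\<close> in \<open>S\<close>,
  follows a shortest walk to some \<open>b\<close> in \<open>S\<close>, and climbs to
  \<open>v\<close>. The middle walk may leave \<open>S\<close>, since \<open>set_diam\<close>
  measures distances in all of \<open>G\<close>.\<close>

lemma (in sym_digraph) graph_dist_layers_le:
  assumes "finite (verts G)" "connected G" "S \<subseteq> verts G"
    and u: "u \<in> layer G S i" and v: "v \<in> layer G S j"
  shows "graph_dist G u v \<le> i + set_diam G S + j"
proof -
  obtain a q where a: "a \<in> S" "awalk u q a" "length q = i"
    using layer_awalks[OF assms(3) u] by blast
  obtain b r where b: "b \<in> S" "awalk b r v" "length r = j"
    using layer_awalks[OF assms(3) v] by blast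
  have "a \<rightarrow>\<^sup>*\<^bsub>G\<^esub> b"
    using symmetric_connected_imp_strongly_connected[OF sym_arcs assms(2)] assms(3) a(1) b(1)
    by (auto simp: strongly_connected_def)
  then obtain s where s: "awalk a s b" "length s = graph_dist G a b"
    by (metis graph_dist_attained reachable_awalk)
  have "awalk u (q @ s @ r) v" using a b s by (auto intro!: awalk_appendI)
  then have "graph_dist G u v \<le> i + graph_dist G a b + j"
    using graph_dist_le_length[of G u "q @ s @ r" v] a(3) b(3) s(2) by simp
  moreover have "graph_dist G a b \<le> set_diam G S"
    using a(1) b(1) assms(1,3) by (intro graph_dist_le_set_diam) (auto intro: finite_subset)
  ultimately show ?thesis by linarith
qed

text \<open>Scaling an injective numbering by \<open>diam G + 1\<close> separates all labels enough
  whatever the distances. Hence the infimum in \<open>radio_number\<close> ranges over a nonempty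
  set and is attained.\<close>

lemma ex_radio_labeling:
  assumes "finite (verts G)"
  shows "\<exists>\<phi>. radio_labeling G \<phi>"
proof -
  obtain f :: "'a \<Rightarrow> nat" where f: "inj_on f (verts G)"
    using finite_imp_inj_to_nat_seg[OF assms] by blast
  have "radio_labeling G (\<lambda>v. f v * (diam G + 1))"
    unfolding radio_labeling_def
  proof (intro ballI impI)
    fix u v assume "u \<in> verts G" "v \<in> verts G" "u \<noteq> v"
    then have "f u \<noteq> f v"
      using f by (auto dest: inj_onD)
    then have "1 \<le> \<bar>int (f u) - int (f v)\<bar>"
      by linarith
    then have "1 * (int (diam G) + 1) \<le> \<bar>int (f u) - int (f v)\<bar> * (int (diam G) + 1)"
      by (intro mult_right_mono) auto
    also have "\<dots> = \<bar>int (f u * (diam G + 1)) - int (f v * (diam G + 1))\<bar>"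
      by (simp only: of_nat_mult of_nat_add of_nat_1 left_diff_distrib[symmetric] abs_mult)
    finally show "int (diam G) + 1 \<le> int (graph_dist G u v)
        + \<bar>int (f u * (diam G + 1)) - int (f v * (diam G + 1))\<bar>"
      unfolding mult_1 by (rule add_increasing[OF of_nat_0_le_iff])
  qed
  then show ?thesis by blast
qed

lemma label_diff_le_label_span:
  assumes "finite (verts G)" "u \<in> verts G" "v \<in> verts G"
  shows "int (\<phi> u) - int (\<phi> v) \<le> int (label_span G \<phi>)"
proof -
  have "nat \<bar>int (\<phi> u) - int (\<phi> v)\<bar> \<le> label_span G \<phi>"
    unfolding label_span_def using assms
    by (intro Max_ge) (auto intro!: image_eqI[of _ _ "(u, v)"])
  then show ?thesis by linarith
qed

text \<open>Induction in increasing order of \<open>f\<close>: each new maximum \<open>x\<close>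
  adds a gap of at least \<open>c - l x - l M\<close> above the old maximum \<open>M\<close>. In the
  telescoped sum inner elements lose their level twice and the two ends only once, hence the
  correction \<open>l m + l M\<close>.\<close>

lemma separated_labels_spread:
  fixes f :: "'a \<Rightarrow> nat" and l :: "'a \<Rightarrow> int" and c :: int
  assumes "finite A" "A \<noteq> {}"
    and "\<And>u v. u \<in> A \<Longrightarrow> v \<in> A \<Longrightarrow> u \<noteq> v \<Longrightarrow> c - l u - l v \<le> \<bar>int (f u) - int (f v)\<bar>"
  shows "\<exists>m\<in>A. \<exists>M\<in>A. (card A \<ge> 2 \<longrightarrow> m \<noteq> M) \<and>
    (int (card A) - 1) * c - 2 * (\<Sum>v\<in>A. l v) + l m + l M \<le> int (f M) - int (f m)"
  using assms
proof (induction A rule: finite_ranking_induct[where f = f])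
  case empty
  then show ?case by simp
next
  case (insert x S)
  show ?case
  \<comment> \<open>The ranking induction does not guarantee that \<open>x\<close> is new, so a
    repeated insertion is treated apart, as is the singleton, where
    \<open>m = M = x\<close>.\<close>
  proof (cases "S = {} \<or> x \<in> S")
    case True
    then consider "S = {}" | "S \<noteq> {}" "insert x S = S" by blast
    then show ?thesis
    proof cases
      case 1
      then show ?thesis by simp
    next
      case 2
      then show ?thesis using insert.IH insert.prems(2) by simp
    qed
  next
    case False
    then have "S \<noteq> {}" "x \<notin> S" by auto
    obtain m M where m: "m \<in> S" and M: "M \<in> S" and
      IH: "(int (card S) - 1) * c - 2 * (\<Sum>v\<in>S. l v) + l m + l M \<le> int (f M) - int (f m)"
      using insert.IH[OF \<open>S \<noteq> {}\<close>] insert.prems(2) by blast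
    have "x \<noteq> M" "x \<noteq> m" using \<open>x \<notin> S\<close> m M by auto
    \<comment> \<open>The absolute value disappears because \<open>f x\<close> is at least every
      earlier value.\<close>
    then have "c - l x - l M \<le> int (f x) - int (f M)"
      using insert.prems(2)[of x M] insert.hyps(2)[OF M] M by auto
    with IH have "(int (card (insert x S)) - 1) * c - 2 * (\<Sum>v\<in>insert x S. l v) + l m + l x
        \<le> int (f x) - int (f m)"
      using insert.hyps(1) \<open>x \<notin> S\<close> by (simp add: algebra_simps)
    then show ?thesis
      using m \<open>x \<noteq> m\<close> by (intro bexI[of _ m] bexI[of _ x] conjI impI) auto
  qed
qed

theorem theorem1:
  fixes G :: "('a, 'b) pre_digraph" and L0 :: "'a set" and L :: "nat \<Rightarrow> 'a set"
    and p d k h :: nat and \<delta> :: int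
  assumes "graph G" and "connected G"
    and "p = card (verts G)" and "p \<ge> 2"
    and "d = diam G"
    and "L0 \<subseteq> verts G" and "L0 \<noteq> {}"
    and "k = set_diam G L0"
    and "L = layer G L0"
    and "h = last_layer G L0"
    and "\<delta> = (if card L0 \<ge> 2 then 0 else 1)"
  shows "int (radio_number G) \<ge>
    (int p - 1) * (int d - int k + 1) + \<delta> - 2 * (\<Sum>i = 0..h. int (card (L i)) * int i)"
proof -
  interpret graph G by fact
  obtain a where a: "a \<in> L0" using assms(7) by blast
  have "\<exists>i. v \<in> L i" if "v \<in> verts G" for v
  proof -
    have "a \<rightarrow>\<^sup>*\<^bsub>G\<^esub> v"
      using symmetric_connected_imp_strongly_connected[OF sym_arcs assms(2)] assms(6) a that
      by (auto simp: strongly_connected_def)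
    then obtain q where "awalk a q v" by (auto simp: reachable_awalk)
    then show ?thesis using awalk_end_in_layer[of a q v L0 0] a assms(9) by simp
  qed
  then obtain l where l: "\<And>v. v \<in> verts G \<Longrightarrow> v \<in> L (l v)" by metis
  have l_le: "l v \<le> h" if "v \<in> verts G" for v
    using layer_index_le_last_layer[OF finite_verts assms(6)] l[OF that] assms(9,10) by blast
  have finL: "finite (L i)" for i
    using layer_subset_verts[OF assms(6)] finite_verts assms(9) finite_subset by metis

  \<comment> \<open>Group the vertices by level. An upper bound suffices, since this sum enters the
    final estimate with a negative sign.\<close>
  have "(\<Sum>v\<in>verts G. int (l v)) = (\<Sum>i = 0..h. \<Sum>v | v \<in> verts G \<and> l v = i. int (l v))"
    using l_le by (intro sum.group[symmetric]) auto
  also have "\<dots> = (\<Sum>i = 0..h. int (card {v \<in> verts G. l v = i}) * int i)"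
    by (intro sum.cong) auto
  also have "\<dots> \<le> (\<Sum>i = 0..h. int (card (L i)) * int i)"
    using l finL by (intro sum_mono mult_right_mono) (auto intro!: card_mono)
  finally have sum_l: "(\<Sum>v\<in>verts G. int (l v)) \<le> (\<Sum>i = 0..h. int (card (L i)) * int i)" .

  obtain \<phi> where \<phi>: "radio_labeling G \<phi>" and span: "radio_number G = label_span G \<phi>"
  proof -
    have "radio_number G \<in> label_span G ` {\<phi>. radio_labeling G \<phi>}"
      unfolding radio_number_def using ex_radio_labeling[OF finite_verts]
      by (intro Inf_nat_def1) auto
    then show ?thesis using that by blast
  qed
  \<comment> \<open>The label gap forced between two vertices of \<open>L0\<close>, whose distance
    is at most \<open>k\<close>.\<close>
  define c where "c = int d - int k + 1"
  have sep: "c - int (l u) - int (l v) \<le> \<bar>int (\<phi> u) - int (\<phi> v)\<bar>"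
    if "u \<in> verts G" "v \<in> verts G" "u \<noteq> v" for u v
  proof -
    have "graph_dist G u v \<le> l u + k + l v"
      using graph_dist_layers_le[OF finite_verts assms(2,6)] l that assms(8,9) by blast
    moreover have "int d + 1 \<le> int (graph_dist G u v) + \<bar>int (\<phi> u) - int (\<phi> v)\<bar>"
      using \<phi> that assms(5) unfolding radio_labeling_def by blast
    ultimately show ?thesis unfolding c_def by linarith
  qed
  have "verts G \<noteq> {}" using a assms(6) by blast
  \<comment> \<open>Here \<open>p \<ge> 2\<close> makes the two extreme vertices distinct.\<close>
  from separated_labels_spread[where l = "\<lambda>v. int (l v)", OF finite_verts this sep]
  obtain m M where mM: "m \<in> verts G" "M \<in> verts G" "m \<noteq> M"
    and spread: "(int p - 1) * c - 2 * (\<Sum>v\<in>verts G. int (l v)) + int (l m) + int (l M)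
      \<le> int (\<phi> M) - int (\<phi> m)"
    using assms(3,4) by blast

  \<comment> \<open>If both levels were 0, the distinct vertices \<open>m\<close> and
    \<open>M\<close> would lie in \<open>L0\<close>, forcing \<open>\<delta> = 0\<close>.\<close>
  have "\<delta> \<le> int (l m) + int (l M)"
  proof (rule ccontr)
    assume "\<not> ?thesis"
    then have "card L0 < 2" and "l m = 0" "l M = 0"
      using assms(11) by (auto split: if_splits)
    then have "{m, M} \<subseteq> L0" using l[OF mM(1)] l[OF mM(2)] assms(9) by simp
    then have "2 \<le> card L0"
      using card_mono[of L0 "{m, M}"] finL[of 0] mM(3) assms(9) by simp
    with \<open>card L0 < 2\<close> show False by simp
  qed
  moreover have "int (\<phi> M) - int (\<phi> m) \<le> int (radio_number G)"
    using label_diff_le_label_span[OF finite_verts mM(2,1)] span by simp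
  ultimately show ?thesis using spread sum_l unfolding c_def by linarith
qed

end
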